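(* Let $q=p^m$ be a power of an odd prime $p$, and let $N_\alpha$ $(\alpha\in\mathbb{F}_q)$ be the $(0,1)$-matrices of order $(2q+3)q^2$ defined in the context. (1) For $\alpha\in\mathbb{F}_q$, $$N_\alpha N_\alpha^t=2q^2I_{q^2(2q+3)}+2qJ_{q^2(2q+3)}+q\sum_{a\in\mathbb{F}_q\cup\{y\}}\left(V^{2\varphi(a)}+V^{-2\varphi(a)}\right)\otimes C_{a,0}.$$ (2) $N_0$ is the adjacency matrix of a Deza graph with parameters $(q^2(2q+3),\,2q^2+2q,\,3q,\,2q)$. (3) For every $\alpha\in\mathbb{F}_q^*=\mathbb{F}_q\setminus\{0\}$, $N_\alpha$ is the adjacency matrix of a directed Deza graph of type II with parameters $(q^2(2q+3),\,2q^2+2q,\,3q,\,2q)$.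
   Context: $I_r$ and $J_r$ are the identity and all-ones matrices of order $r$, and $\otimes$ is the Kronecker product. Identify the additive group of $\mathbb{F}_q$ with $\mathbb{F}_p^m$. Let $U=\mathrm{circ}(0,1,0,\ldots,0)$ be the circulant matrix of order $p$ with first row $(0,1,0,\ldots,0)$, and define the group homomorphism $\phi:\mathbb{F}_q\to GL_q(\mathbb{R})$ by $\phi((x_i)_{i=1}^m)=\bigotimes_{i=1}^mU^{x_i}$. For $\alpha,\alpha'\in\mathbb{F}_q$ let $C_{\alpha,\alpha'}$ be the $q^2\times q^2$ $(0,1)$-matrix which is a $q\times q$ block matrix, with blocks indexed by $\beta,\beta'\in\mathbb{F}_q$, whose $(\beta,\beta')$-block is $\phi(\alpha(-\beta+\beta')+\alpha')$. Let $y$ be an additional symbol not in $\mathbb{F}_q$ and put $C_{y,\alpha}=\phi(\alpha)\otimes J_q$ for $\alpha\in\mathbb{F}_q$. Let $x$ be a further symbol and let $L$ be the circulant matrix of order $2q+3$ with first row $(a_1,\ldots,a_{2q+3})$, where $a_1=x$, $a_2=y$, $\{a_i:3\le i\le q+2\}=\mathbb{F}_q$, and $a_{2q+4-i}=a_{i+1}$ for $1\le i\le 2q+2$ (so $L$ is symmetric). Write $L=\sum_{a\in\mathbb{F}_q\cup\{x,y\}}a\cdot P_a$ with $(0,1)$-matrices $P_a$; thus $P_x=I_{2q+3}$. Let $V$ be the shift matrix (the circulant matrix with first row $(0,1,0,\ldots,0)$) of order $2q+3$ and let $\varphi:\mathbb{F}_q\cup\{y\}\to\{1,\ldots,q+1\}$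 be the bijection with $P_a=V^{\varphi(a)}+V^{-\varphi(a)}$. For $\alpha\in\mathbb{F}_q$ define $N_\alpha=\sum_{a\in\mathbb{F}_q\cup\{y\}}P_a\otimes C_{a,\alpha}$. A Deza graph with parameters $(n,k,b,a)$, $a\le b$, is a $k$-regular simple graph on $n$ vertices such that any two distinct vertices have $a$ or $b$ common neighbours. A digraph (no loops, at most one arc from one vertex to another) is a directed Deza graph of type II with parameters $(n,k,b,a)$, where $0\le a\le b\le k\le n$, if it has $n$ vertices, every vertex has in-degree and out-degree $k$, and for any distinct vertices $u,v$ the number of vertices $w$ with $u\rightarrow w\leftarrow v$ and the number of vertices $w$ with $u\leftarrow w\rightarrow v$ coincide and equal $a$ or $b$. The adjacency matrix has $(i,j)$-entry $1$ iff $i\rightarrow j$. *)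

theory Defs
  imports
    "Jordan_Normal_Form.Gauss_Jordan_Elimination"
    "Graph_Theory.Pair_Digraph"
    "HOL-Library.FuncSet"
    "HOL-Computational_Algebra.Primes"
begin

text \<open>Rows and columns of matrices are numbered from 0, as usual for \<^typ>\<open>'a mat\<close>.\<close>

definition all_ones :: "nat \<Rightarrow> real mat" where
  "all_ones r = mat r r (\<lambda>_. 1)"

text \<open>The circulant matrix with the given first row: every row is the previous one rotated
  one place to the right. The entries need not be numbers.\<close>

definition circ :: "'a list \<Rightarrow> 'a mat" where
  "circ xs = mat (length xs) (length xs) (\<lambda>(i, j). xs ! ((j + length xs - i) mod length xs))"

text \<open>Only meant for order at least 2.\<close>

definition shift_mat :: "nat \<Rightarrow> real mat" where
  "shift_mat n = circ (0 # 1 # replicate (n - 2) 0)"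

text \<open>Integer powers; a negative exponent is only meaningful for an invertible matrix.\<close>

definition mat_powi :: "real mat \<Rightarrow> int \<Rightarrow> real mat" where
  "mat_powi A k =
     (if 0 \<le> k then A ^\<^sub>m nat k else the (mat_inverse A) ^\<^sub>m nat (- k))"

definition kron :: "real mat \<Rightarrow> real mat \<Rightarrow> real mat" where
  "kron A B = mat (dim_row A * dim_row B) (dim_col A * dim_col B)
     (\<lambda>(i, j). A $$ (i div dim_row B, j div dim_col B) * B $$ (i mod dim_row B, j mod dim_col B))"

text \<open>Sum of a family of square matrices of order \<^term>\<open>n\<close>.\<close>

definition mat_sum :: "nat \<Rightarrow> ('i \<Rightarrow> real mat) \<Rightarrow> 'i set \<Rightarrow> real mat" where
  "mat_sum n f S = mat n n (\<lambda>ij. \<Sum>s\<in>S. f s $$ ij)"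

text \<open>An identification \<^term>\<open>crd\<close> of the additive group of a field with the group of \<open>m\<close>-tuples
  over the field with \<open>p\<close> elements. The latter field is represented by the residues
  \<open>0, \<dots>, p - 1\<close>, and \<open>m\<close>-tuples by extensional functions on \<open>{1..m}\<close>.\<close>

definition coordinatization :: "nat \<Rightarrow> nat \<Rightarrow> ('f::field \<Rightarrow> nat \<Rightarrow> nat) \<Rightarrow> bool" where
  "coordinatization p m crd \<longleftrightarrow>
     bij_betw crd UNIV ({1..m} \<rightarrow>\<^sub>E {..<p}) \<and>
     (\<forall>x y. \<forall>i\<in>{1..m}. crd (x + y) i = (crd x i + crd y i) mod p)"

text \<open>The Kronecker product of the \<open>x\<^sub>i\<close>-th powers of \<open>U\<close>, for \<open>i = 1, \<dots>, m\<close>;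
  \<open>1\<^sub>m 1\<close> is the neutral element of \<^const>\<open>kron\<close>.\<close>

definition phi_mat :: "nat \<Rightarrow> nat \<Rightarrow> ('f \<Rightarrow> nat \<Rightarrow> nat) \<Rightarrow> 'f \<Rightarrow> real mat" where
  "phi_mat p m crd x = foldr kron (map (\<lambda>i. shift_mat p ^\<^sub>m crd x i) [1..<m + 1]) (1\<^sub>m 1)"

text \<open>The field elements together with the two additional symbols \<open>x\<close> and \<open>y\<close>.\<close>

datatype 'f symbol = SymX | SymY | Fld 'f

definition index_symbols :: "'f symbol set" where
  "index_symbols = insert SymY (range Fld)"

text \<open>\<open>C_mat p m crd e a \<alpha>'\<close> is the matrix with indices \<open>a\<close> and \<open>\<alpha>'\<close>, of order \<open>q\<^sup>2\<close> where
  \<open>q = p ^ m\<close>. The enumeration \<open>e\<close> of the field on \<open>{..<q}\<close> says which field element labels the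
  \<open>k\<close>-th row and column of blocks, so that \<open>i div q\<close> selects the block and \<open>i mod q\<close> the
  position within it. There is deliberately no equation for \<^const>\<open>SymX\<close>.\<close>

primrec C_mat ::
  "nat \<Rightarrow> nat \<Rightarrow> ('f::field \<Rightarrow> nat \<Rightarrow> nat) \<Rightarrow> (nat \<Rightarrow> 'f) \<Rightarrow> 'f symbol \<Rightarrow> 'f \<Rightarrow> real mat" where
  "C_mat p m crd e (Fld \<alpha>) = (\<lambda>\<alpha>'. let q = p ^ m in mat (q ^ 2) (q ^ 2)
     (\<lambda>(i, j). phi_mat p m crd (\<alpha> * (- e (i div q) + e (j div q)) + \<alpha>') $$ (i mod q, j mod q)))"
| "C_mat p m crd e SymY = (\<lambda>\<alpha>'. kron (phi_mat p m crd \<alpha>') (all_ones (p ^ m)))"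

text \<open>The first row of \<open>L\<close> is \<open>s 1, \<dots>, s (2 * q + 3)\<close>; note the numbering from 1.\<close>

definition L_mat :: "nat \<Rightarrow> (nat \<Rightarrow> 'f symbol) \<Rightarrow> 'f symbol mat" where
  "L_mat q s = circ (map s [1..<2 * q + 4])"

definition P_mat :: "nat \<Rightarrow> (nat \<Rightarrow> 'f symbol) \<Rightarrow> 'f symbol \<Rightarrow> real mat" where
  "P_mat q s a = map_mat (\<lambda>b. if b = a then 1 else 0) (L_mat q s)"

definition N_mat ::
  "nat \<Rightarrow> nat \<Rightarrow> ('f::field \<Rightarrow> nat \<Rightarrow> nat) \<Rightarrow> (nat \<Rightarrow> 'f) \<Rightarrow> (nat \<Rightarrow> 'f symbol) \<Rightarrow> 'f \<Rightarrow> real mat"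
where
  "N_mat p m crd e s \<alpha> = (let q = p ^ m in
     mat_sum (q ^ 2 * (2 * q + 3)) (\<lambda>a. kron (P_mat q s a) (C_mat p m crd e a \<alpha>)) index_symbols)"

text \<open>A \<^const>\<open>pair_digraph\<close> is a finite digraph without loops and without parallel arcs; a pair of
  opposite arcs is allowed. A \<^const>\<open>pair_graph\<close> (a symmetric \<^const>\<open>pair_digraph\<close>) represents a
  simple graph, an edge being a pair of opposite arcs; the degree of a vertex is then its
  out-degree.\<close>

definition deza_graph :: "'v pair_pre_digraph \<Rightarrow> nat \<Rightarrow> nat \<Rightarrow> nat \<Rightarrow> nat \<Rightarrow> bool" where
  "deza_graph G n k b a \<longleftrightarrow>
     pair_graph G \<and> card (pverts G) = n \<and> a \<le> b \<and>
     (\<forall>v\<in>pverts G. out_degree (with_proj G) v = k) \<and>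
     (\<forall>u\<in>pverts G. \<forall>v\<in>pverts G. u \<noteq> v \<longrightarrow>
        card {w. (u, w) \<in> parcs G \<and> (v, w) \<in> parcs G} \<in> {a, b})"

definition directed_deza_graph_II ::
  "'v pair_pre_digraph \<Rightarrow> nat \<Rightarrow> nat \<Rightarrow> nat \<Rightarrow> nat \<Rightarrow> bool" where
  "directed_deza_graph_II G n k b a \<longleftrightarrow>
     pair_digraph G \<and> card (pverts G) = n \<and> a \<le> b \<and> b \<le> k \<and> k \<le> n \<and>
     (\<forall>v\<in>pverts G. in_degree (with_proj G) v = k \<and> out_degree (with_proj G) v = k) \<and>
     (\<forall>u\<in>pverts G. \<forall>v\<in>pverts G. u \<noteq> v \<longrightarrow>
        card {w. (u, w) \<in> parcs G \<and> (v, w) \<in> parcs G} =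
          card {w. (w, u) \<in> parcs G \<and> (w, v) \<in> parcs G} \<and>
        card {w. (u, w) \<in> parcs G \<and> (v, w) \<in> parcs G} \<in> {a, b})"

definition is_adjacency_mat :: "real mat \<Rightarrow> nat pair_pre_digraph \<Rightarrow> bool" where
  "is_adjacency_mat A G \<longleftrightarrow>
     square_mat A \<and> pverts G = {..<dim_row A} \<and>
     (\<forall>i\<in>pverts G. \<forall>j\<in>pverts G. A $$ (i, j) = (if (i, j) \<in> parcs G then 1 else 0))"

end

theory Submission
  imports Defs "Jordan_Normal_Form.Determinant"
begin

text \<open>Each matrix involved is a \<open>(0,1)\<close>-matrix given by a relation on row and column numbers:
  the matrix \<^const>\<open>phi_mat\<close> of \<open>x\<close> relates \<open>i\<close> to \<open>j\<close> iff \<open>g j = g i + x\<close> for a bijection \<open>g\<close> onto the field, read off from base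
  \<open>p\<close> digits, and \<open>P\<^sub>a\<close> relates \<open>I\<close> to \<open>J\<close> iff their distance in the cycle of length \<open>2q + 3\<close> is
  \<open>\<phi> a\<close>. Counting solutions of linear equations over the field gives
  \<open>C\<^bsub>a,\<alpha>\<^esub> C\<^bsub>b,\<alpha>\<^esub>\<^sup>t = J\<close> for \<open>a \<noteq> b\<close>, \<open>C\<^bsub>a,\<alpha>\<^esub> C\<^bsub>a,\<alpha>\<^esub>\<^sup>t = q C\<^bsub>a,0\<^esub>\<close> and \<open>\<Sum>\<^sub>a C\<^bsub>a,0\<^esub> = q I + J\<close>. In the
  block \<open>(I, J)\<close>, \<open>I \<noteq> J\<close>, of \<open>N\<^sub>\<alpha> N\<^sub>\<alpha>\<^sup>t\<close> all intermediate \<open>K\<close> contribute \<open>J\<close>, except the unique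
  \<open>K\<close> equidistant from \<open>I\<close> and \<open>J\<close>, which contributes \<open>q C\<^bsub>a,0\<^esub>\<close>; the diagonal blocks use that each
  distance occurs twice. Since \<open>C\<^bsub>a,\<alpha>\<^esub>\<^sup>t = C\<^bsub>a,-\<alpha>\<^esub>\<close>, also \<open>N\<^sub>\<alpha>\<^sup>t = N\<^bsub>-\<alpha>\<^esub>\<close>, so \<open>N\<^sub>0\<close> is symmetric, and
  as the Gram matrix does not depend on \<open>\<alpha>\<close>, common in-neighbours are counted by it as well. The
  degrees are its diagonal entries.\<close>

subsection \<open>Powers of the shift matrix\<close>

text \<open>A general step \<open>c\<close> is allowed so that one induction serves the shift matrix
  (\<open>c = 1\<close>) and its inverse (\<open>c = n - 1\<close>).\<close>

lemma pow_translation_mat_index: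
  fixes A :: "'a::semiring_1 mat"
  assumes A: "A \<in> carrier_mat n n"
    and transl: "\<And>i j. i < n \<Longrightarrow> j < n \<Longrightarrow> A $$ (i, j) = of_bool (j = (i + c) mod n)"
    and "i < n" "j < n"
  shows "(A ^\<^sub>m k) $$ (i, j) = of_bool (j = (i + c * k) mod n)"
  using assms(4)
proof (induction k arbitrary: j)
  case 0
  then show ?case using A \<open>i < n\<close> by auto
next
  case (Suc k)
  have "(A ^\<^sub>m Suc k) $$ (i, j) = (\<Sum>l<n. (A ^\<^sub>m k) $$ (i, l) * A $$ (l, j))"
    using A pow_carrier_mat[OF A, of k] Suc.prems \<open>i < n\<close>
    by (simp add: scalar_prod_def atLeast0LessThan)
  also have "\<dots> = (\<Sum>l<n. if l = (i + c * k) mod n then of_bool (j = (l + c) mod n) else 0)"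
    using Suc transl by (intro sum.cong) auto
  also have "\<dots> = of_bool (j = (i + c * Suc k) mod n)"
    using Suc.prems by (simp add: mod_simps algebra_simps)
  finally show ?case .
qed

lemma shift_mat_carrier: "2 \<le> n \<Longrightarrow> shift_mat n \<in> carrier_mat n n"
  by (auto simp: shift_mat_def circ_def)

lemma shift_mat_index:
  assumes "2 \<le> n" "i < n" "j < n"
  shows "shift_mat n $$ (i, j) = of_bool (j = (i + 1) mod n)"
proof -
  have len: "length (0 # 1 # replicate (n - 2) (0::real)) = n" using assms by simp
  have nth: "(0 # 1 # replicate (n - 2) (0::real)) ! k = of_bool (k = 1)" if "k < n" for k
    using that by (auto simp: nth_Cons split: nat.splits)
  have "(j + n - i) mod n = 1 \<longleftrightarrow> j = (i + 1) mod n"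
    using assms by (cases "i \<le> j"; cases "i + 1 = n") (auto simp: mod_if)
  then show ?thesis
    using assms by (simp only: shift_mat_def circ_def len index_mat nth split) (simp add: nth)
qed

lemma shift_mat_pow_carrier: "2 \<le> n \<Longrightarrow> shift_mat n ^\<^sub>m k \<in> carrier_mat n n"
  by (simp add: pow_carrier_mat shift_mat_carrier)

lemma shift_mat_pow_index:
  assumes "2 \<le> n" "i < n" "j < n"
  shows "(shift_mat n ^\<^sub>m k) $$ (i, j) = of_bool (j = (i + k) mod n)"
  using pow_translation_mat_index[OF shift_mat_carrier shift_mat_index] assms by simp

text \<open>Shifting \<open>n\<close> times is the identity, so the power \<open>n - 1\<close> is a
  two-sided inverse. This rules out \<open>None\<close>, and uniqueness of inverses identifies the
  matrix under \<open>Some\<close>. It gives negative exponents in \<open>mat_powi\<close> their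
  meaning.\<close>

lemma mat_inverse_shift_mat:
  assumes "2 \<le> n"
  shows "mat_inverse (shift_mat n) = Some (shift_mat n ^\<^sub>m (n - 1))"
proof -
  let ?V = "shift_mat n"
  have C: "?V ^\<^sub>m k \<in> carrier_mat n n" "?V \<in> carrier_mat n n" for k
    using assms by (simp_all add: shift_mat_carrier shift_mat_pow_carrier)
  have one: "?V ^\<^sub>m n = 1\<^sub>m n"
    by (rule eq_matI) (use C(2) assms in \<open>auto simp: shift_mat_pow_index\<close>)
  have r: "?V ^\<^sub>m (n - 1) * ?V = 1\<^sub>m n"
    using one assms by (cases n) auto
  then have l: "?V * ?V ^\<^sub>m (n - 1) = 1\<^sub>m n"
    using mat_mult_left_right_inverse[OF C(1) C(2)] by simp
  show ?thesis
  proof (cases "mat_inverse ?V")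
    case None
    then have "?V \<notin> Units (ring_mat TYPE(real) n ())"
      using mat_inverse(1)[OF C(2), where b = "()"] by blast
    then show ?thesis using r l C by (auto simp: Units_def ring_mat_def)
  next
    case (Some B)
    then have B: "?V * B = 1\<^sub>m n" "B * ?V = 1\<^sub>m n" "B \<in> carrier_mat n n"
      using mat_inverse(2)[OF C(2)] by auto
    have "B = (?V ^\<^sub>m (n - 1) * ?V) * B" using r B by simp
    also have "\<dots> = ?V ^\<^sub>m (n - 1)" using B C by (simp add: assoc_mult_mat[of _ n n _ n _ n])
    finally show ?thesis using Some by simp
  qed
qed

lemma mat_powi_shift_carrier: "2 \<le> n \<Longrightarrow> mat_powi (shift_mat n) k \<in> carrier_mat n n"
  by (simp add: mat_powi_def mat_inverse_shift_mat shift_mat_pow_carrier pow_carrier_mat)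

lemma mat_powi_shift_index:
  assumes "2 \<le> n" "i < n" "j < n"
  shows "mat_powi (shift_mat n) k $$ (i, j) = of_bool (int j = (int i + k) mod int n)"
proof (cases "0 \<le> k")
  case True
  then have "j = (i + nat k) mod n \<longleftrightarrow> int j = (int i + k) mod int n"
    by (metis int_nat_eq of_nat_add of_nat_eq_iff of_nat_mod)
  with True assms show ?thesis by (simp add: mat_powi_def shift_mat_pow_index)
next
  case False
  define t where "t = nat (- k)"
  \<comment> \<open>The inverse translates by \<open>n - 1\<close>, which is -1 modulo
    \<open>n\<close>; hence its power \<open>t\<close> translates by \<open>k = - t\<close>.\<close>
  have "((shift_mat n ^\<^sub>m (n - 1)) ^\<^sub>m t) $$ (i, j) = of_bool (j = (i + (n - 1) * t) mod n)"
    using assms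
    by (intro pow_translation_mat_index) (simp_all add: shift_mat_pow_carrier shift_mat_pow_index)
  moreover have "j = (i + (n - 1) * t) mod n \<longleftrightarrow> int j = (int i + k) mod int n"
  proof -
    have "int ((i + (n - 1) * t) mod n) = (int i + (int n - 1) * int t) mod int n"
      using assms by (simp add: of_nat_mod of_nat_diff)
    also have "int i + (int n - 1) * int t = (int i + k) + int n * int t"
      using False by (simp add: t_def algebra_simps)
    finally show ?thesis by (metis mod_mult_self2 of_nat_eq_iff)
  qed
  ultimately show ?thesis
    using False assms by (simp add: mat_powi_def mat_inverse_shift_mat t_def)
qed

text \<open>With the exponent smaller than \<open>n\<close> in absolute value,
  \<open>int i + k\<close> leaves the range of residues by at most one period. Three linear
  equations thus replace the congruence, and linear arithmetic can take over.\<close>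

lemma mat_powi_shift_index_le:
  assumes "2 \<le> n" "i < n" "j < n" "\<bar>k\<bar> < int n"
  shows "mat_powi (shift_mat n) k $$ (i, j)
    = of_bool (int j - int i - k \<in> {- int n, 0, int n})"
proof -
  have "int j = (int i + k) mod int n \<longleftrightarrow> int j - int i - k \<in> {- int n, 0, int n}"
  proof -
    consider "int i + k < 0" | "0 \<le> int i + k" "int i + k < int n" | "int n \<le> int i + k"
      by linarith
    then show ?thesis
    proof cases
      case 1
      then have "(int i + k) mod int n = int i + k + int n"
        using assms by (intro int_mod_pos_eq[where q = "-1"]) auto
      then show ?thesis using 1 assms by auto
    next
      case 2
      then show ?thesis using assms by auto
    next
      case 3
      then have "(int i + k) mod int n = int i + k - int n"
        using assms by (intro int_mod_pos_eq[where q = 1]) auto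
      then show ?thesis using 3 assms by auto
    qed
  qed
  then show ?thesis by (simp only: mat_powi_shift_index[OF assms(1-3)])
qed

subsection \<open>Distances in an odd cycle\<close>

text \<open>Distance in the cycle on \<^term>\<open>{..<n}\<close>.\<close>

definition cdist :: "nat \<Rightarrow> nat \<Rightarrow> nat \<Rightarrow> nat" where
  "cdist n i j = (let d = (if i \<le> j then j - i else i - j) in min d (n - d))"

lemma cdist_commute: "cdist n i j = cdist n j i"
  by (simp add: cdist_def)

lemma cdist_eq_0_iff: "i < n \<Longrightarrow> j < n \<Longrightarrow> cdist n i j = 0 \<longleftrightarrow> i = j"
  by (auto simp: cdist_def Let_def)

lemma cdist_le: "odd n \<Longrightarrow> 2 * cdist n i j < n"
proof -
  have "2 * min d (n - d) \<le> n" for d by (auto simp: min_def)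
  then have "2 * cdist n i j \<le> n" by (simp add: cdist_def Let_def)
  moreover assume "odd n"
  then have "2 * cdist n i j \<noteq> n" by (metis dvd_triv_left)
  ultimately show ?thesis by simp
qed

text \<open>For \<open>k\<close> below half of \<open>n\<close>, the minimum of \<open>d\<close> and
  \<open>n - d\<close> is \<open>k\<close> iff one of the two is \<open>k\<close>. The resulting
  congruences, j = i + k or j = i - k modulo \<open>n\<close>, are written additively to avoid
  truncated subtraction.\<close>

lemma cdist_eq_iff:
  assumes "i < n" "j < n" "2 * k < n"
  shows "cdist n i j = k \<longleftrightarrow> j = i + k \<or> i = j + k \<or> j + n = i + k \<or> i + n = j + k"
  using assms by (cases "i \<le> j") (auto simp: cdist_def Let_def min_def)

lemma shift_powi_sum_index:
  assumes "i < n" "j < n" "1 \<le> k" "2 * k < n"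
  shows "(mat_powi (shift_mat n) (int k) + mat_powi (shift_mat n) (- int k)) $$ (i, j)
    = of_bool (cdist n i j = k)"
proof -
  have n: "2 \<le> n" using assms by simp
  let ?P = "int j - int i - int k \<in> {- int n, 0, int n}"
  let ?Q = "int j - int i - - int k \<in> {- int n, 0, int n}"
  have "(mat_powi (shift_mat n) (int k) + mat_powi (shift_mat n) (- int k)) $$ (i, j)
    = mat_powi (shift_mat n) (int k) $$ (i, j) + mat_powi (shift_mat n) (- int k) $$ (i, j)"
    using assms carrier_matD[OF mat_powi_shift_carrier[OF n]] by simp
  also have "\<dots> = of_bool ?P + of_bool ?Q"
    using assms n by (intro arg_cong2[of _ _ _ _ "(+)"] mat_powi_shift_index_le) auto
  also have "\<dots> = of_bool (cdist n i j = k)"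
  proof -
    \<comment> \<open>Each condition loses one of its three cases because the indices are below
      \<open>n\<close> and \<open>k\<close> is positive. Both together would make
      \<open>2 * k\<close> a multiple of \<open>n\<close>, so the sum of the two indicators is the
      indicator of the disjunction.\<close>
    have P: "?P \<longleftrightarrow> j = i + k \<or> j + n = i + k" using assms by auto
    have Q: "?Q \<longleftrightarrow> i = j + k \<or> i + n = j + k" using assms by auto
    show ?thesis
      unfolding P Q cdist_eq_iff[OF assms(1,2,4)] using assms by auto
  qed
  finally show ?thesis .
qed

text \<open>In a cycle of odd length, two distinct vertices have a unique equidistant vertex.\<close>

definition cmid :: "nat \<Rightarrow> nat \<Rightarrow> nat \<Rightarrow> nat" where
  "cmid n i j = (if even (i + j) then (i + j) div 2
     else if i + j < n then (i + j + n) div 2 else (i + j - n) div 2)"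

text \<open>\<open>cmid\<close> is half of \<open>i + j\<close> modulo \<open>n\<close>: if
  \<open>i + j\<close> is odd, adding or subtracting the odd \<open>n\<close> makes it even.\<close>

lemma two_cmid:
  assumes "odd n"
  shows "2 * cmid n i j = i + j \<or> 2 * cmid n i j = i + j + n \<or> 2 * cmid n i j + n = i + j"
  using assms by (auto simp: cmid_def)

lemma cmid_less: "i < n \<Longrightarrow> j < n \<Longrightarrow> odd n \<Longrightarrow> cmid n i j < n"
  by (auto simp: cmid_def)

text \<open>Equal distances mean that k - i is k - j or its negative modulo \<open>n\<close>. The
  first would force \<open>i = j\<close>; the second says 2k = i + j, which has one solution since 2
  is invertible modulo the odd \<open>n\<close>.\<close>

lemma cdist_eq_iff_cmid:
  assumes "i < n" "j < n" "odd n" "i \<noteq> j" "k < n"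
  shows "cdist n i k = cdist n j k \<longleftrightarrow> k = cmid n i j"
proof -
  define d where "d = cdist n j k"
  define c where "c = cmid n i j"
  have parity: "2 * x \<noteq> 2 * y + n" for x y :: nat
    using \<open>odd n\<close> by presburger
  have d: "2 * d < n" "k = j + d \<or> j = k + d \<or> k + n = j + d \<or> j + n = k + d"
    using cdist_le[OF assms(3), of j k] cdist_eq_iff[OF assms(2,5), of d] by (auto simp: d_def)
  have c: "c < n" "2 * c = i + j \<or> 2 * c = i + j + n \<or> 2 * c + n = i + j"
    using two_cmid[OF assms(3)] cmid_less[OF assms(1-3)] by (auto simp: c_def)
  have "cdist n i k = d \<longleftrightarrow> k = i + d \<or> i = k + d \<or> k + n = i + d \<or> i + n = k + d"
    using cdist_eq_iff[OF assms(1,5) d(1)] .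
  moreover have "(k = i + d \<or> i = k + d \<or> k + n = i + d \<or> i + n = k + d) \<longleftrightarrow> k = c"
  proof
    assume *: "k = i + d \<or> i = k + d \<or> k + n = i + d \<or> i + n = k + d"
    have "2 * k = i + j \<or> 2 * k = i + j + n \<or> 2 * k + n = i + j"
      using * d assms c(1) by (elim disjE) auto
    then show "k = c"
      using c assms(5) parity[of k c] parity[of c k] by (elim disjE) auto
  next
    assume "k = c"
    then show "k = i + d \<or> i = k + d \<or> k + n = i + d \<or> i + n = k + d"
      using d(2) c assms d(1) by (elim disjE) auto
  qed
  ultimately show ?thesis by (simp add: d_def c_def)
qed

text \<open>Since \<open>2 * k\<close> may exceed half of \<open>n\<close>, it need not be a cyclic
  distance. Being \<open>2 * k\<close> steps apart in either direction is therefore expressed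
  through the midpoint, which then lies \<open>k\<close> steps from \<open>i\<close>.\<close>

lemma shift_powi_double_sum_index:
  assumes "i < n" "j < n" "odd n" "1 \<le> k" "2 * k < n"
  shows "(mat_powi (shift_mat n) (2 * int k) + mat_powi (shift_mat n) (- 2 * int k)) $$ (i, j)
    = of_bool (i \<noteq> j \<and> cdist n i (cmid n i j) = k)"
proof -
  have n: "2 \<le> n" using assms by simp
  let ?P = "int j - int i - 2 * int k \<in> {- int n, 0, int n}"
  let ?Q = "int j - int i - - 2 * int k \<in> {- int n, 0, int n}"
  have "(mat_powi (shift_mat n) (2 * int k) + mat_powi (shift_mat n) (- 2 * int k)) $$ (i, j)
    = mat_powi (shift_mat n) (2 * int k) $$ (i, j) + mat_powi (shift_mat n) (- 2 * int k) $$ (i, j)"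
    using assms carrier_matD[OF mat_powi_shift_carrier[OF n]] by simp
  also have "\<dots> = of_bool ?P + of_bool ?Q"
    using assms n by (intro arg_cong2[of _ _ _ _ "(+)"] mat_powi_shift_index_le) auto
  also have "\<dots> = of_bool (i \<noteq> j \<and> cdist n i (cmid n i j) = k)"
  proof -
    have P: "?P \<longleftrightarrow> j = i + 2 * k \<or> j + n = i + 2 * k" using assms by auto
    have Q: "?Q \<longleftrightarrow> i = j + 2 * k \<or> i + n = j + 2 * k" using assms by auto
    \<comment> \<open>Both conditions together make \<open>4 * k\<close> a multiple of
      \<open>n\<close>. As it lies strictly between 0 and \<open>2 * n\<close>, it would equal the
      odd \<open>n\<close>.\<close>
    have "n \<noteq> 2 * (2 * k)" using \<open>odd n\<close> by (metis dvd_triv_left)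
    then have "\<not> (?P \<and> ?Q)" unfolding P Q using assms by auto
    moreover have "?P \<or> ?Q \<longleftrightarrow> i \<noteq> j \<and> cdist n i (cmid n i j) = k"
    proof -
      define c where "c = cmid n i j"
      have parity: "2 * x \<noteq> 2 * y + n" for x y :: nat
        using \<open>odd n\<close> by presburger
      have c: "c < n" "2 * c = i + j \<or> 2 * c = i + j + n \<or> 2 * c + n = i + j"
        using two_cmid[OF assms(3)] cmid_less[OF assms(1-3)] by (auto simp: c_def)
      have "?P \<or> ?Q \<longleftrightarrow> j = i + 2 * k \<or> j + n = i + 2 * k \<or> i = j + 2 * k \<or> i + n = j + 2 * k"
        unfolding P Q by blast
      also have "\<dots> \<longleftrightarrow> i \<noteq> j \<and> (c = i + k \<or> i = c + k \<or> c + n = i + k \<or> i + n = c + k)"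
      proof
        assume *: "j = i + 2 * k \<or> j + n = i + 2 * k \<or> i = j + 2 * k \<or> i + n = j + 2 * k"
        then have "i \<noteq> j" using assms parity[of 0 k] parity[of k 0] by auto
        moreover have "c = i + k \<or> i = c + k \<or> c + n = i + k \<or> i + n = c + k"
        proof -
          \<comment> \<open>Halving the first four equations gives the goal; in the last four, two
            even numbers differ by the odd \<open>n\<close>, which \<open>parity\<close>
            excludes.\<close>
          have "2 * c = 2 * (i + k) \<or> 2 * i = 2 * (c + k)
            \<or> 2 * (c + n) = 2 * (i + k) \<or> 2 * (i + n) = 2 * (c + k)
            \<or> 2 * (i + k) = 2 * c + n \<or> 2 * c = 2 * (i + k) + n
            \<or> 2 * (c + k) = 2 * i + n \<or> 2 * i = 2 * (c + k) + n"
            using * c(2) by (elim disjE) auto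
          then show ?thesis
            using parity[of "i + k" c] parity[of c "i + k"] parity[of "c + k" i] parity[of i "c + k"]
            by auto
        qed
        ultimately show "i \<noteq> j \<and> (c = i + k \<or> i = c + k \<or> c + n = i + k \<or> i + n = c + k)" ..
      next
        assume "i \<noteq> j \<and> (c = i + k \<or> i = c + k \<or> c + n = i + k \<or> i + n = c + k)"
        then have "i \<noteq> j" "c = i + k \<or> i = c + k \<or> c + n = i + k \<or> i + n = c + k" by auto
        from this(2) show "j = i + 2 * k \<or> j + n = i + 2 * k \<or> i = j + 2 * k \<or> i + n = j + 2 * k"
          using c assms by (elim disjE) auto
      qed
      also have "\<dots> \<longleftrightarrow> i \<noteq> j \<and> cdist n i c = k"
        using cdist_eq_iff[OF assms(1) c(1) assms(5)] by simp
      finally show ?thesis by (simp only: c_def)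
    qed
    ultimately show ?thesis by (auto simp: of_bool_def)
  qed
  finally show ?thesis .
qed

lemma card_cdist_eq:
  assumes "i < n" "1 \<le> k" "2 * k < n"
  shows "card {j. j < n \<and> cdist n i j = k} = 2"
proof -
  \<comment> \<open>\<open>a\<close> and \<open>b\<close> are i + k and i - k reduced modulo
    \<open>n\<close>; they differ because \<open>2 * k\<close> is positive and below
    \<open>n\<close>.\<close>
  define a where "a = (if i + k < n then i + k else i + k - n)"
  define b where "b = (if k \<le> i then i - k else i + n - k)"
  have "j < n \<and> cdist n i j = k \<longleftrightarrow> j = a \<or> j = b" for j
    using assms cdist_eq_iff[of i n j k] unfolding a_def b_def by (cases "j < n") auto
  then have "{j. j < n \<and> cdist n i j = k} = {a, b}" by auto
  moreover have "a \<noteq> b" using assms by (auto simp: a_def b_def)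
  ultimately show ?thesis by simp
qed

subsection \<open>The homomorphism into permutation matrices\<close>

lemma kron_index:
  assumes "A \<in> carrier_mat a a" "B \<in> carrier_mat b b" "i < a * b" "j < a * b"
  shows "kron A B $$ (i, j) = A $$ (i div b, j div b) * B $$ (i mod b, j mod b)"
  using assms by (auto simp: kron_def)

lemma kron_carrier_square:
  assumes "A \<in> carrier_mat a a" "B \<in> carrier_mat b b"
  shows "kron A B \<in> carrier_mat (a * b) (a * b)"
  using assms by (auto simp: kron_def)

text \<open>The induction runs over the last \<open>l\<close> factors, because a new left factor of
  a Kronecker product adds a new leading base \<open>p\<close> digit and leaves the lower ones
  alone. Digit \<open>r\<close> is therefore shifted by the exponent of factor
  \<open>m - r\<close>.\<close>

lemma kron_shift_pows:
  fixes c :: "nat \<Rightarrow> nat"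
  assumes p: "2 \<le> p" and "l \<le> m"
  defines "M \<equiv> foldr kron (map (\<lambda>i. shift_mat p ^\<^sub>m c i) [m + 1 - l..<m + 1]) (1\<^sub>m 1)"
  shows "M \<in> carrier_mat (p ^ l) (p ^ l)
    \<and> (\<forall>i<p ^ l. \<forall>j<p ^ l. M $$ (i, j) =
        of_bool (\<forall>r<l. (j div p ^ r) mod p = (i div p ^ r + c (m - r)) mod p))"
  using \<open>l \<le> m\<close> unfolding M_def
proof (induction l)
  case (Suc l)
  let ?B = "foldr kron (map (\<lambda>i. shift_mat p ^\<^sub>m c i) [m + 1 - l..<m + 1]) (1\<^sub>m 1)"
  let ?A = "shift_mat p ^\<^sub>m c (m - l)"
  have IH: "?B \<in> carrier_mat (p ^ l) (p ^ l)"
    "\<And>i j. i < p ^ l \<Longrightarrow> j < p ^ l \<Longrightarrow> ?B $$ (i, j)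
      = of_bool (\<forall>r<l. (j div p ^ r) mod p = (i div p ^ r + c (m - r)) mod p)"
    using Suc by auto
  have A: "?A \<in> carrier_mat p p" by (rule shift_mat_pow_carrier[OF p])
  have "[m + 1 - Suc l..<m + 1] = (m - l) # [m + 1 - l..<m + 1]"
    using Suc.prems by (subst upt_conv_Cons) (auto simp: Suc_diff_le)
  then have eq: "foldr kron (map (\<lambda>i. shift_mat p ^\<^sub>m c i) [m + 1 - Suc l..<m + 1]) (1\<^sub>m 1) = kron ?A ?B"
    by simp
  have "kron ?A ?B $$ (i, j)
      = of_bool (\<forall>r<Suc l. (j div p ^ r) mod p = (i div p ^ r + c (m - r)) mod p)"
    if ij: "i < p ^ Suc l" "j < p ^ Suc l" for i j
  proof -
    have lt: "i div p ^ l < p" "j div p ^ l < p"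
      using ij p by (auto simp: less_mult_imp_div_less mult.commute)
    have low: "(x mod p ^ l) div p ^ r mod p = x div p ^ r mod p" if "r < l" for x r
    proof -
      have "p ^ l = p ^ r * p ^ (l - r)" using that by (simp flip: power_add)
      then have "(x mod p ^ l) div p ^ r = (x div p ^ r) mod p ^ (l - r)"
        using p by (simp add: mod_mult2_eq)
      moreover have "p dvd p ^ (l - r)" using that by (simp add: dvd_power)
      ultimately show ?thesis by (simp add: mod_mod_cancel)
    qed
    have "kron ?A ?B $$ (i, j)
        = ?A $$ (i div p ^ l, j div p ^ l) * ?B $$ (i mod p ^ l, j mod p ^ l)"
      using ij by (intro kron_index[OF A IH(1)]) auto
    also have "?A $$ (i div p ^ l, j div p ^ l)
        = of_bool ((j div p ^ l) mod p = (i div p ^ l + c (m - l)) mod p)"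
      using lt p by (simp add: shift_mat_pow_index)
    also have "?B $$ (i mod p ^ l, j mod p ^ l)
        = of_bool (\<forall>r<l. (j div p ^ r) mod p = (i div p ^ r + c (m - r)) mod p)"
    proof -
      have "?B $$ (i mod p ^ l, j mod p ^ l) = of_bool (\<forall>r<l. (j mod p ^ l) div p ^ r mod p
          = ((i mod p ^ l) div p ^ r + c (m - r)) mod p)"
        using p by (intro IH(2)) auto
      also have "(\<forall>r<l. (j mod p ^ l) div p ^ r mod p
          = ((i mod p ^ l) div p ^ r + c (m - r)) mod p)
        \<longleftrightarrow> (\<forall>r<l. (j div p ^ r) mod p = (i div p ^ r + c (m - r)) mod p)"
        by (metis low mod_add_left_eq)
      finally show ?thesis .
    qed
    finally show ?thesis by (auto simp: less_Suc_eq)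
  qed
  then show ?case unfolding eq using kron_carrier_square[OF A IH(1)] by simp
qed simp

lemma eq_if_digits_eq:
  fixes i j p :: nat
  assumes "i < p ^ l" "j < p ^ l" "\<And>r. r < l \<Longrightarrow> (i div p ^ r) mod p = (j div p ^ r) mod p"
  shows "i = j"
  using assms
proof (induction l arbitrary: i j)
  case (Suc l)
  have "i div p = j div p"
  proof (rule Suc.IH)
    show "i div p < p ^ l" "j div p < p ^ l"
      using Suc.prems(1,2) by (auto simp: less_mult_imp_div_less mult.commute)
    show "i div p div p ^ r mod p = j div p div p ^ r mod p" if "r < l" for r
      using Suc.prems(3)[of "Suc r"] that by (simp add: div_mult2_eq)
  qed
  moreover have "i mod p = j mod p" using Suc.prems(3)[of 0] by simp
  ultimately show ?case by (metis div_mult_mod_eq)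
qed simp

text \<open>The first tensor factor of \<^const>\<open>phi_mat\<close> corresponds to the most significant base \<open>p\<close> digit
  of a row number.\<close>

lemma phi_mat_translation:
  fixes crd :: "'f::{finite,field} \<Rightarrow> nat \<Rightarrow> nat"
  assumes p: "2 \<le> p" and card: "card (UNIV :: 'f set) = p ^ m" and crd: "coordinatization p m crd"
  obtains g where "bij_betw g {..<p ^ m} UNIV"
    and "\<And>x. phi_mat p m crd x \<in> carrier_mat (p ^ m) (p ^ m)"
    and "\<And>x i j. i < p ^ m \<Longrightarrow> j < p ^ m \<Longrightarrow> phi_mat p m crd x $$ (i, j) = of_bool (g j = g i + x)"
proof
  \<comment> \<open>Row \<open>i\<close> is to be labelled by the field element whose coordinate
    \<open>k\<close> is the digit of \<open>i\<close> of weight \<open>p ^ (m - k)\<close>.\<close>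
  define dig where "dig i = (\<lambda>k\<in>{1..m}. (i div p ^ (m - k)) mod p)" for i
  define g where "g i = the_inv_into UNIV crd (dig i)" for i
  have add: "crd (x + y) k = (crd x k + crd y k) mod p" if "k \<in> {1..m}" for x y k
    using crd that by (simp add: coordinatization_def)
  have inj: "inj crd" and range: "range crd = ({1..m} \<rightarrow>\<^sub>E {..<p})"
    using crd by (auto simp: coordinatization_def bij_betw_def)
  have dig: "dig i \<in> range crd" for i
    using p unfolding range dig_def by auto
  have crd_g: "crd (g i) = dig i" for i
    unfolding g_def by (rule f_the_inv_into_f[OF inj dig])
  have dig_eq: "dig i (m - r) = i div p ^ r mod p" if "r < m" for i r
    using that by (simp add: dig_def)
  have "inj_on g {..<p ^ m}"
  proof (rule inj_onI)
    fix i j assume ij: "i \<in> {..<p ^ m}" "j \<in> {..<p ^ m}" "g i = g j"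
    then have "dig i = dig j" by (metis crd_g)
    then show "i = j" using ij by (intro eq_if_digits_eq[of i p m j]) (auto simp flip: dig_eq)
  qed
  moreover from this have "g ` {..<p ^ m} = UNIV"
    by (intro card_subset_eq) (auto simp: card_image card)
  ultimately show "bij_betw g {..<p ^ m} UNIV" by (simp add: bij_betw_def)
  fix x :: 'f
  note ind = kron_shift_pows[OF p order_refl[of m], of "crd x"]
  then show "phi_mat p m crd x \<in> carrier_mat (p ^ m) (p ^ m)"
    by (simp add: phi_mat_def)
  fix i j assume ij: "i < p ^ m" "j < p ^ m"
  have "phi_mat p m crd x $$ (i, j)
      = of_bool (\<forall>r<m. (j div p ^ r) mod p = (i div p ^ r + crd x (m - r)) mod p)"
    using ind ij by (simp add: phi_mat_def)
  also have "(\<forall>r<m. (j div p ^ r) mod p = (i div p ^ r + crd x (m - r)) mod p)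
      \<longleftrightarrow> (\<forall>r<m. crd (g j) (m - r) = crd (g i + x) (m - r))"
    by (auto simp: add crd_g dig_eq mod_simps)
  also have "\<dots> \<longleftrightarrow> (\<forall>k\<in>{1..m}. crd (g j) k = crd (g i + x) k)"
  proof (intro iffI ballI allI impI)
    fix k assume "\<forall>r<m. crd (g j) (m - r) = crd (g i + x) (m - r)" "k \<in> {1..m}"
    then show "crd (g j) k = crd (g i + x) k" 
      by (auto dest!: spec[of _ "m - k"])
  qed auto
  also have "\<dots> \<longleftrightarrow> crd (g j) = crd (g i + x)"
  proof -
    have "crd y \<in> {1..m} \<rightarrow>\<^sub>E {..<p}" for y using range by blast
    then show ?thesis by (metis PiE_ext)
  qed
  also have "\<dots> \<longleftrightarrow> g j = g i + x" using inj by (auto dest: injD)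
  finally show "phi_mat p m crd x $$ (i, j) = of_bool (g j = g i + x)" .
qed

subsection \<open>The blocks\<close>

lemma sum_div_mod:
  fixes f :: "nat \<Rightarrow> nat \<Rightarrow> 'a::comm_monoid_add"
  shows "(\<Sum>k<a * b. f (k div b) (k mod b)) = (\<Sum>x<a. \<Sum>y<b. f x y)"
proof -
  have "(\<Sum>k<a * b. f (k div b) (k mod b)) = (\<Sum>x<a. \<Sum>k\<in>{x * b..<x * b + b}. f (k div b) (k mod b))"
    by (rule sum.nat_group[symmetric])
  also have "\<dots> = (\<Sum>x<a. \<Sum>y<b. f x y)"
  proof (rule sum.cong)
    fix x
    have "(\<Sum>k\<in>{x * b..<x * b + b}. f (k div b) (k mod b))
        = (\<Sum>y\<in>{0..<b}. f ((y + x * b) div b) ((y + x * b) mod b))"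
      using sum.shift_bounds_nat_ivl[of "\<lambda>k. f (k div b) (k mod b)" 0 "x * b" b]
      by (simp add: add.commute)
    also have "\<dots> = (\<Sum>y<b. f x y)"
      unfolding atLeast0LessThan by (rule sum.cong) auto
    finally show "(\<Sum>k\<in>{x * b..<x * b + b}. f (k div b) (k mod b)) = (\<Sum>y<b. f x y)" .
  qed simp
  finally show ?thesis .
qed

lemma finite_index_symbols: "finite (index_symbols :: 'f::finite symbol set)"
  by (simp add: index_symbols_def)

lemma sum_index_symbols:
  fixes h :: "'f::finite symbol \<Rightarrow> 'a::comm_monoid_add"
  shows "sum h index_symbols = h SymY + (\<Sum>x\<in>UNIV. h (Fld x))"
proof -
  have "SymY \<notin> (range Fld :: 'f symbol set)" "inj (Fld :: 'f \<Rightarrow> _)" by (auto simp: inj_on_def)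
  then show ?thesis by (simp add: index_symbols_def sum.reindex)
qed

lemma index_symbols_cases:
  assumes "a \<in> index_symbols"
  obtains x where "a = Fld x" | "a = SymY"
  using assms by (auto simp: index_symbols_def)

lemma sum_of_bool_eq_mult:
  "(\<Sum>x\<in>UNIV. of_bool (x = u) * of_bool (x = v)) = (of_bool ((u::'a::finite) = v) :: real)"
proof -
  have "(\<Sum>x\<in>UNIV. of_bool (x = u) * of_bool (x = v)) = (\<Sum>x\<in>UNIV. if x = u then of_bool (u = v) else 0 :: real)"
    by (rule sum.cong) auto
  then show ?thesis by simp
qed

section \<open>Rows of the blocks as lines over the finite field\<close>

locale block_matrices =
  fixes p m q :: nat
    and crd :: "'f::{finite,field} \<Rightarrow> nat \<Rightarrow> nat"
    and e g :: "nat \<Rightarrow> 'f"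
  assumes q: "q = p ^ m" "q > 0"
    and e: "bij_betw e {..<q} UNIV"
    and g: "bij_betw g {..<q} UNIV"
    and phi_carrier: "phi_mat p m crd x \<in> carrier_mat q q"
    and phi_index: "i < q \<Longrightarrow> j < q \<Longrightarrow> phi_mat p m crd x $$ (i, j) = of_bool (g j = g i + x)"
begin

text \<open>In the field case \<open>e\<close> labels the blocks and \<open>g\<close> the positions
  inside them. For \<open>SymY\<close> the matrix \<open>phi_mat\<close> is the left Kronecker
  factor, so there \<open>g\<close> is applied to block numbers.\<close>

primrec C_rel :: "'f symbol \<Rightarrow> 'f \<Rightarrow> nat \<Rightarrow> nat \<Rightarrow> bool" where
  "C_rel (Fld a) = (\<lambda>\<alpha> i j. g (j mod q) = g (i mod q) + a * (e (j div q) - e (i div q)) + \<alpha>)"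
| "C_rel SymY = (\<lambda>\<alpha> i j. g (j div q) = g (i div q) + \<alpha>)"

lemma C_mat_carrier: "a \<in> index_symbols \<Longrightarrow> C_mat p m crd e a \<alpha> \<in> carrier_mat (q\<^sup>2) (q\<^sup>2)"
  using kron_carrier_square[OF phi_carrier, of "all_ones q" q \<alpha>]
  by (elim index_symbols_cases)
    (simp_all add: q(1)[symmetric] all_ones_def Let_def power2_eq_square)

lemma div_less_q: "i < q\<^sup>2 \<Longrightarrow> i div q < q"
  by (simp add: less_mult_imp_div_less power2_eq_square)

lemma C_mat_index:
  assumes "a \<in> index_symbols" "i < q\<^sup>2" "j < q\<^sup>2"
  shows "C_mat p m crd e a \<alpha> $$ (i, j) = of_bool (C_rel a \<alpha> i j)"
  using assms(1)
proof (cases rule: index_symbols_cases)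
  case (1 x)
  then show ?thesis using assms q(2)
    by (simp add: Let_def q(1)[symmetric] phi_index algebra_simps)
next
  case 2
  have J: "all_ones q \<in> carrier_mat q q" by (simp add: all_ones_def)
  have "kron (phi_mat p m crd \<alpha>) (all_ones q) $$ (i, j)
    = phi_mat p m crd \<alpha> $$ (i div q, j div q) * all_ones q $$ (i mod q, j mod q)"
    using assms by (intro kron_index[OF phi_carrier J]) (auto simp: power2_eq_square)
  then show ?thesis
    using assms q(2) 2 by (simp add: q(1)[symmetric] phi_index div_less_q all_ones_def)
qed

lemma C_rel_swap:
  assumes "a \<in> index_symbols"
  shows "C_rel a \<alpha> j i \<longleftrightarrow> C_rel a (- \<alpha>) i j"
  using assms by (elim index_symbols_cases) (auto simp: algebra_simps)

lemma sum_enumerated: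
  assumes "bij_betw h {..<q} UNIV"
  shows "(\<Sum>k<q. f (h k)) = (\<Sum>x\<in>UNIV. f (x::'f))"
  by (rule sum.reindex_bij_betw[OF assms])

lemma g_eq_iff: "i < q \<Longrightarrow> j < q \<Longrightarrow> g i = g j \<longleftrightarrow> i = j"
  using g by (auto simp: bij_betw_def inj_on_def)

lemma e_eq_iff: "i < q \<Longrightarrow> j < q \<Longrightarrow> e i = e j \<longleftrightarrow> i = j"
  using e by (auto simp: bij_betw_def inj_on_def)

lemma card_field: "card (UNIV :: 'f set) = q"
  using bij_betw_same_card[OF e] by simp

lemma sum_of_bool_unique:
  assumes "\<And>x::'f. P x \<longleftrightarrow> x = c"
  shows "(\<Sum>x\<in>UNIV. of_bool (P x)) = (1::real)"
  using assms by simp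

text \<open>Give column \<open>c\<close> the coordinates \<open>e (c div q)\<close> and
  \<open>g (c mod q)\<close> in the affine plane over the field. A row for \<open>Fld x\<close> is
  then a line of slope \<open>x\<close>, and a row for \<open>SymY\<close> a vertical line. Lines of
  different directions meet once; parallel ones are disjoint or share all \<open>q\<close> points.
  The common shift by \<alpha> does not affect whether parallel lines coincide.\<close>

lemma C_rel_row_product:
  assumes "a \<in> index_symbols" "b \<in> index_symbols"
  shows "(\<Sum>c<q\<^sup>2. of_bool (C_rel a \<alpha> i c) * of_bool (C_rel b \<alpha> j c))
    = (if a = b then real q * of_bool (C_rel a 0 i j) else 1)"
proof -
  have YY: ?thesis if "a = SymY" "b = SymY"
  proof -
    have "(\<Sum>c<q\<^sup>2. of_bool (C_rel a \<alpha> i c) * of_bool (C_rel b \<alpha> j c))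
        = (\<Sum>c<q * q. of_bool (g (c div q) = g (i div q) + \<alpha>) * of_bool (g (c div q) = g (j div q) + \<alpha>))"
      using that by (simp add: power2_eq_square)
    \<comment> \<open>The position inside the block is unconstrained, hence the factor
      \<open>q\<close>.\<close>
    also have "\<dots> = real q * (\<Sum>k<q. of_bool (g k = g (i div q) + \<alpha>) * of_bool (g k = g (j div q) + \<alpha>))"
      by (subst sum_div_mod[of "\<lambda>k z. of_bool (g k = _) * of_bool (g k = _)"])
        (simp only: sum_constant card_lessThan sum_distrib_left)
    also have "\<dots> = real q * (\<Sum>x\<in>UNIV. of_bool (x = g (i div q) + \<alpha>) * of_bool (x = g (j div q) + \<alpha>))"
      by (subst sum_enumerated[OF g, of "\<lambda>x. of_bool (x = _) * of_bool (x = _)"]) simp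
    also have "\<dots> = real q * of_bool (C_rel a 0 i j)"
      using that by (auto simp: sum_of_bool_eq_mult)
    finally show ?thesis using that by simp
  qed
  have FY: "(\<Sum>c<q\<^sup>2. of_bool (C_rel (Fld x) \<alpha> i' c) * of_bool (C_rel SymY \<alpha> j' c)) = (1::real)"
    for x i' j'
  proof -
    have "(\<Sum>c<q\<^sup>2. of_bool (C_rel (Fld x) \<alpha> i' c) * of_bool (C_rel SymY \<alpha> j' c))
      = (\<Sum>c<q * q. of_bool (g (c mod q) = g (i' mod q) + x * (e (c div q) - e (i' div q)) + \<alpha>)
          * (of_bool (g (c div q) = g (j' div q) + \<alpha>) :: real))"
      by (simp add: power2_eq_square)
    also have "\<dots> = (\<Sum>k<q. \<Sum>z<q. of_bool (g z = g (i' mod q) + x * (e k - e (i' div q)) + \<alpha>)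
          * of_bool (g k = g (j' div q) + \<alpha>))"
      by (subst sum_div_mod[of "\<lambda>k z. of_bool (g z = _ + x * (e k - _) + \<alpha>) * of_bool (g k = _)"]) simp
    also have "\<dots> = (\<Sum>k<q. of_bool (g k = g (j' div q) + \<alpha>))"
    proof (rule sum.cong)
      fix k
      show "(\<Sum>z<q. of_bool (g z = g (i' mod q) + x * (e k - e (i' div q)) + \<alpha>)
          * of_bool (g k = g (j' div q) + \<alpha>)) = (of_bool (g k = g (j' div q) + \<alpha>) :: real)"
        by (subst sum_enumerated[OF g, of "\<lambda>w. of_bool (w = _) * _"]) simp
    qed simp
    also have "\<dots> = 1"
      by (subst sum_enumerated[OF g, of "\<lambda>w. of_bool (w = _)"]) simp
    finally show ?thesis .
  qed
  have FF: "(\<Sum>c<q\<^sup>2. of_bool (C_rel (Fld x) \<alpha> i c) * of_bool (C_rel (Fld y) \<alpha> j c))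
    = (if x = y then real q * of_bool (C_rel (Fld x) 0 i j) else 1)" for x y
  proof -
    let ?u = "\<lambda>t. g (i mod q) + x * (t - e (i div q)) + \<alpha>"
    let ?v = "\<lambda>t. g (j mod q) + y * (t - e (j div q)) + \<alpha>"
    have "(\<Sum>c<q\<^sup>2. of_bool (C_rel (Fld x) \<alpha> i c) * of_bool (C_rel (Fld y) \<alpha> j c))
      = (\<Sum>c<q * q. of_bool (g (c mod q) = ?u (e (c div q))) * (of_bool (g (c mod q) = ?v (e (c div q))) :: real))"
      by (simp add: power2_eq_square)
    also have "\<dots> = (\<Sum>k<q. \<Sum>z<q. of_bool (g z = ?u (e k)) * of_bool (g z = ?v (e k)))"
      by (subst sum_div_mod[of "\<lambda>k z. of_bool (g z = ?u (e k)) * of_bool (g z = ?v (e k))"]) simp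
    also have "\<dots> = (\<Sum>k<q. of_bool (?u (e k) = ?v (e k)))"
    proof (rule sum.cong)
      fix k
      show "(\<Sum>z<q. of_bool (g z = ?u (e k)) * of_bool (g z = ?v (e k)))
          = (of_bool (?u (e k) = ?v (e k)) :: real)"
        by (subst sum_enumerated[OF g, of "\<lambda>w. of_bool (w = _) * of_bool (w = _)"])
          (rule sum_of_bool_eq_mult)
    qed simp
    also have "\<dots> = (\<Sum>t\<in>UNIV. of_bool (?u t = ?v t))"
      by (rule sum_enumerated[OF e])
    also have "\<dots> = (if x = y then real q * of_bool (C_rel (Fld x) 0 i j) else 1)"
    proof (cases "x = y")
      case True
      have "?u t = ?v t \<longleftrightarrow> C_rel (Fld x) 0 i j" for t
        using True by (auto simp: algebra_simps)
      then show ?thesis using True by (simp add: card_field)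
    next
      case False
      define d where "d = (g (j mod q) - y * e (j div q)) - (g (i mod q) - x * e (i div q))"
      \<comment> \<open>The slopes differ, so the two lines meet over exactly one first coordinate
        \<open>t\<close>.\<close>
      have "?u t = ?v t \<longleftrightarrow> t = d / (x - y)" for t
      proof -
        have "?u t = ?v t \<longleftrightarrow> t * (x - y) = d"
          by (auto simp: d_def algebra_simps)
        then show ?thesis using False by (simp add: eq_divide_eq)
      qed
      then show ?thesis using False by simp
    qed
    finally show ?thesis .
  qed
  show ?thesis
    using assms(1)
  proof (cases rule: index_symbols_cases)
    case (1 x)
    from assms(2) show ?thesis
      by (cases rule: index_symbols_cases) (use 1 FF FY in auto)
  next
    case 2
    from assms(2) show ?thesis
    proof (cases rule: index_symbols_cases)
      case (1 y)
      then show ?thesis using 2 FY[of y j i] by (simp add: mult.commute)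
    qed (use 2 YY in auto)
  qed
qed

text \<open>In the same plane, the relation with shift 0 says that the points \<open>i\<close> and
  \<open>j\<close> lie on a common line of direction \<open>a\<close>. Distinct points have one
  joining line; a point lies on a line in each of the \<open>q + 1\<close> directions.\<close>

lemma sum_C_rel:
  assumes "i < q\<^sup>2" "j < q\<^sup>2"
  shows "(\<Sum>a\<in>index_symbols. of_bool (C_rel a 0 i j)) = real q * of_bool (i = j) + 1"
proof (cases "i div q = j div q")
  case True
  have "i = j \<longleftrightarrow> i mod q = j mod q"
    using True by (metis div_mult_mod_eq)
  also have "\<dots> \<longleftrightarrow> g (j mod q) = g (i mod q)"
    using g_eq_iff q(2) by auto
  finally show ?thesis
    using True by (simp add: sum_index_symbols card_field)
next
  case False
  then have ne: "e (j div q) - e (i div q) \<noteq> 0" "g (j div q) \<noteq> g (i div q)"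
    using assms by (auto simp: e_eq_iff g_eq_iff div_less_q)
  have "C_rel (Fld x) 0 i j \<longleftrightarrow> x = (g (j mod q) - g (i mod q)) / (e (j div q) - e (i div q))" for x
    using ne(1) by (auto simp: eq_divide_eq algebra_simps)
  then have "(\<Sum>x\<in>UNIV. of_bool (C_rel (Fld x) 0 i j)) = (1::real)"
    by (rule sum_of_bool_unique)
  then show ?thesis
    using ne(2) False by (auto simp: sum_index_symbols)
qed

end

subsection \<open>The Gram matrix and the graphs\<close>

locale deza_construction = block_matrices p m q crd e g
  for p m q :: nat
    and crd :: "'f::{finite,field} \<Rightarrow> nat \<Rightarrow> nat"
    and e g :: "nat \<Rightarrow> 'f" +
  fixes s :: "nat \<Rightarrow> 'f symbol"
    and \<phi> :: "'f symbol \<Rightarrow> nat"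
  assumes \<phi>: "bij_betw \<phi> index_symbols {1..q + 1}"
    and P_mat_eq: "a \<in> index_symbols \<Longrightarrow> P_mat q s a =
      mat_powi (shift_mat (2 * q + 3)) (int (\<phi> a)) + mat_powi (shift_mat (2 * q + 3)) (- int (\<phi> a))"
begin

abbreviation M where "M \<equiv> 2 * q + 3"

text \<open>The off-diagonal entries of \<^const>\<open>L_mat\<close>.\<close>

definition label :: "nat \<Rightarrow> nat \<Rightarrow> 'f symbol" where
  "label I J = inv_into index_symbols \<phi> (cdist M I J)"

text \<open>Blocks with equal indices vanish, as \<open>index_symbols\<close> omits
  \<open>SymX\<close>. They must be excluded explicitly: distance 0 is not a value of
  \<open>\<phi>\<close>, so \<open>label\<close> carries no information there.\<close>

definition N_rel :: "'f \<Rightarrow> nat \<Rightarrow> nat \<Rightarrow> bool" where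
  "N_rel \<alpha> i j \<longleftrightarrow> i div q\<^sup>2 \<noteq> j div q\<^sup>2 \<and>
     C_rel (label (i div q\<^sup>2) (j div q\<^sup>2)) \<alpha> (i mod q\<^sup>2) (j mod q\<^sup>2)"

text \<open>This is the relation behind the sum over \<open>a\<close> in the Gram formula. Block
  indices \<open>2 * \<phi> a\<close> steps apart have their midpoint \<open>\<phi> a\<close> steps
  away, so the label towards the midpoint recovers \<open>a\<close>.\<close>

definition T_rel :: "nat \<Rightarrow> nat \<Rightarrow> bool" where
  "T_rel i j \<longleftrightarrow> i div q\<^sup>2 \<noteq> j div q\<^sup>2 \<and>
     C_rel (label (i div q\<^sup>2) (cmid M (i div q\<^sup>2) (j div q\<^sup>2))) 0 (i mod q\<^sup>2) (j mod q\<^sup>2)"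

lemma \<phi>_bounds: "a \<in> index_symbols \<Longrightarrow> 1 \<le> \<phi> a \<and> 2 * \<phi> a < M"
  using bij_betw_apply[OF \<phi>, of a] by auto

lemma cdist_in_range:
  assumes "I < M" "J < M" "I \<noteq> J"
  shows "cdist M I J \<in> {1..q + 1}"
  using cdist_le[of M I J] cdist_eq_0_iff[OF assms(1,2)] assms(3)
  by (cases "cdist M I J") auto

lemma label_in:
  assumes "I < M" "J < M" "I \<noteq> J"
  shows "label I J \<in> index_symbols"
  using cdist_in_range[OF assms] \<phi> unfolding label_def
  by (metis bij_betw_imp_surj_on inv_into_into)

lemma label_eq_iff:
  assumes "I < M" "J < M" "I \<noteq> J" "a \<in> index_symbols"
  shows "label I J = a \<longleftrightarrow> cdist M I J = \<phi> a"
  using cdist_in_range[OF assms(1-3)] \<phi> assms(4) unfolding label_def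
  by (metis bij_betw_inv_into_left bij_betw_inv_into_right)

lemma label_eq_label_iff:
  assumes "I < M" "J < M" "K < M" "I \<noteq> J" "K \<noteq> I" "K \<noteq> J"
  shows "label I K = label J K \<longleftrightarrow> K = cmid M I J"
proof -
  have "label I K = label J K \<longleftrightarrow> cdist M I K = cdist M J K"
    using cdist_in_range[of I K] cdist_in_range[of J K] \<phi> assms unfolding label_def
    by (metis bij_betw_inv_into_right)
  then show ?thesis
    using cdist_eq_iff_cmid[of I M J K] assms by simp
qed

lemma label_commute: "label I J = label J I"
  by (simp add: label_def cdist_commute)

lemma N_rel_swap:
  assumes "i < M * q\<^sup>2" "j < M * q\<^sup>2"
  shows "N_rel \<alpha> j i \<longleftrightarrow> N_rel (- \<alpha>) i j"
proof (cases "i div q\<^sup>2 = j div q\<^sup>2")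
  case False
  have "label (i div q\<^sup>2) (j div q\<^sup>2) \<in> index_symbols"
    using assms False by (intro label_in) (auto simp: less_mult_imp_div_less)
  then show ?thesis
    using C_rel_swap unfolding N_rel_def by (metis label_commute)
qed (auto simp: N_rel_def)

lemma N_mat_carrier: "N_mat p m crd e s \<alpha> \<in> carrier_mat (M * q\<^sup>2) (M * q\<^sup>2)"
  by (simp add: N_mat_def mat_sum_def Let_def q(1)[symmetric] mult.commute)

section \<open>Entries of the matrices and of their Gram matrix\<close>

lemma sum_kron_C_mat_index:
  assumes "i < M * q\<^sup>2" "j < M * q\<^sup>2"
    and "\<And>a. a \<in> index_symbols \<Longrightarrow> B a \<in> carrier_mat M M"
    and "\<And>a. a \<in> index_symbols \<Longrightarrow> B a $$ (i div q\<^sup>2, j div q\<^sup>2) = of_bool (Q \<and> a = c)"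
    and "Q \<Longrightarrow> c \<in> index_symbols"
  shows "mat_sum (M * q\<^sup>2) (\<lambda>a. kron (B a) (C_mat p m crd e a \<alpha>)) index_symbols $$ (i, j)
    = of_bool (Q \<and> C_rel c \<alpha> (i mod q\<^sup>2) (j mod q\<^sup>2))"
proof -
  have "mat_sum (M * q\<^sup>2) (\<lambda>a. kron (B a) (C_mat p m crd e a \<alpha>)) index_symbols $$ (i, j)
      = (\<Sum>a\<in>index_symbols. kron (B a) (C_mat p m crd e a \<alpha>) $$ (i, j))"
    using assms(1,2) by (simp add: mat_sum_def)
  also have "\<dots> = (\<Sum>a\<in>index_symbols.
      if a = c then of_bool (Q \<and> C_rel c \<alpha> (i mod q\<^sup>2) (j mod q\<^sup>2)) else 0)"
  proof (rule sum.cong)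
    fix a :: "'f symbol" assume a: "a \<in> index_symbols"
    have "kron (B a) (C_mat p m crd e a \<alpha>) $$ (i, j)
        = B a $$ (i div q\<^sup>2, j div q\<^sup>2) * C_mat p m crd e a \<alpha> $$ (i mod q\<^sup>2, j mod q\<^sup>2)"
      by (rule kron_index[OF assms(3)[OF a] C_mat_carrier[OF a] assms(1,2)])
    then show "kron (B a) (C_mat p m crd e a \<alpha>) $$ (i, j)
        = (if a = c then of_bool (Q \<and> C_rel c \<alpha> (i mod q\<^sup>2) (j mod q\<^sup>2)) else 0)"
      using q(2) assms(4)[OF a] C_mat_index[OF a, of "i mod q\<^sup>2" "j mod q\<^sup>2"] by auto
  qed simp
  also have "\<dots> = of_bool (Q \<and> C_rel c \<alpha> (i mod q\<^sup>2) (j mod q\<^sup>2))"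
    using assms(5) by (auto simp: finite_index_symbols)
  finally show ?thesis .
qed

lemma N_mat_index:
  assumes "i < M * q\<^sup>2" "j < M * q\<^sup>2"
  shows "N_mat p m crd e s \<alpha> $$ (i, j) = of_bool (N_rel \<alpha> i j)"
proof -
  let ?I = "i div q\<^sup>2" and ?J = "j div q\<^sup>2"
  have IJ: "?I < M" "?J < M" using assms by (auto simp: less_mult_imp_div_less)
  have "mat_sum (M * q\<^sup>2) (\<lambda>a. kron (P_mat q s a) (C_mat p m crd e a \<alpha>)) index_symbols $$ (i, j)
      = of_bool (?I \<noteq> ?J \<and> C_rel (label ?I ?J) \<alpha> (i mod q\<^sup>2) (j mod q\<^sup>2))"
  proof (rule sum_kron_C_mat_index[OF assms])
    fix a :: "'f symbol" assume a: "a \<in> index_symbols"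
    show "P_mat q s a \<in> carrier_mat M M"
      using mat_powi_shift_carrier[of M] by (simp add: P_mat_eq[OF a])
    have "P_mat q s a $$ (?I, ?J) = of_bool (cdist M ?I ?J = \<phi> a)"
      unfolding P_mat_eq[OF a] using IJ \<phi>_bounds[OF a] by (intro shift_powi_sum_index) auto
    also have "cdist M ?I ?J = \<phi> a \<longleftrightarrow> ?I \<noteq> ?J \<and> a = label ?I ?J"
      using label_eq_iff[OF IJ _ a] cdist_eq_0_iff[OF IJ] \<phi>_bounds[OF a] by auto
    finally show "P_mat q s a $$ (?I, ?J) = of_bool (?I \<noteq> ?J \<and> a = label ?I ?J)" .
  qed (use IJ label_in in auto)
  then show ?thesis
    by (simp add: N_mat_def Let_def q(1)[symmetric] N_rel_def mult.commute)
qed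

lemma T_mat_index:
  assumes "i < M * q\<^sup>2" "j < M * q\<^sup>2"
  shows "mat_sum (M * q\<^sup>2) (\<lambda>a. kron (mat_powi (shift_mat M) (2 * int (\<phi> a)) + mat_powi (shift_mat M) (- 2 * int (\<phi> a)))
      (C_mat p m crd e a 0)) index_symbols $$ (i, j) = of_bool (T_rel i j)"
  unfolding T_rel_def
proof (rule sum_kron_C_mat_index[OF assms])
  let ?I = "i div q\<^sup>2" and ?J = "j div q\<^sup>2"
  let ?K = "cmid M ?I ?J"
  have IJ: "?I < M" "?J < M" using assms by (auto simp: less_mult_imp_div_less)
  then have K: "?K < M" by (intro cmid_less) auto
  have ne: "?I \<noteq> ?K" if "?I \<noteq> ?J"
    using cdist_eq_iff_cmid[OF IJ _ that K] cdist_eq_0_iff[OF IJ(1) K] cdist_eq_0_iff[OF IJ(2) K] that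
    by auto
  show "label ?I ?K \<in> index_symbols" if "?I \<noteq> ?J"
    using label_in[OF IJ(1) K ne[OF that]] .
  fix a :: "'f symbol" assume a: "a \<in> index_symbols"
  show "mat_powi (shift_mat M) (2 * int (\<phi> a)) + mat_powi (shift_mat M) (- 2 * int (\<phi> a))
      \<in> carrier_mat M M"
    using mat_powi_shift_carrier[of M] by simp
  have "(mat_powi (shift_mat M) (2 * int (\<phi> a)) + mat_powi (shift_mat M) (- 2 * int (\<phi> a))) $$ (?I, ?J)
      = of_bool (?I \<noteq> ?J \<and> cdist M ?I ?K = \<phi> a)"
    using IJ \<phi>_bounds[OF a] by (intro shift_powi_double_sum_index) auto
  also have "?I \<noteq> ?J \<and> cdist M ?I ?K = \<phi> a \<longleftrightarrow> ?I \<noteq> ?J \<and> a = label ?I ?K"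
    using label_eq_iff[OF IJ(1) K _ a] ne by auto
  finally show "(mat_powi (shift_mat M) (2 * int (\<phi> a)) + mat_powi (shift_mat M) (- 2 * int (\<phi> a))) $$ (?I, ?J)
      = of_bool (?I \<noteq> ?J \<and> a = label ?I ?K)" .
qed

lemma N_rel_row_product:
  assumes "i < M * q\<^sup>2" "j < M * q\<^sup>2"
  shows "(\<Sum>k<M * q\<^sup>2. of_bool (N_rel \<alpha> i k) * of_bool (N_rel \<alpha> j k))
    = real (2 * q\<^sup>2) * of_bool (i = j) + real (2 * q) + real q * of_bool (T_rel i j)"
proof -
  define I i' J j' where "I = i div q\<^sup>2" and "i' = i mod q\<^sup>2" and "J = j div q\<^sup>2" and "j' = j mod q\<^sup>2"
  have IJ: "I < M" "J < M" using assms by (auto simp: less_mult_imp_div_less I_def J_def)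
  have ij': "i' < q\<^sup>2" "j' < q\<^sup>2" using q(2) by (auto simp: i'_def j'_def)
  \<comment> \<open>Only middle block indices other than \<open>I\<close> and \<open>J\<close>
    contribute, and \<open>w K\<close> is the contribution of \<open>K\<close>.\<close>
  define S where "S = {..<M} - {I, J}"
  define w where "w K = (if label I K = label J K then real q * of_bool (C_rel (label I K) 0 i' j') else 1)" for K
  have "(\<Sum>k<M * q\<^sup>2. of_bool (N_rel \<alpha> i k) * of_bool (N_rel \<alpha> j k))
      = (\<Sum>K<M. \<Sum>c<q\<^sup>2. of_bool (I \<noteq> K \<and> C_rel (label I K) \<alpha> i' c)
          * (of_bool (J \<noteq> K \<and> C_rel (label J K) \<alpha> j' c) :: real))"
    unfolding N_rel_def I_def[symmetric] J_def[symmetric] i'_def[symmetric] j'_def[symmetric]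
    by (rule sum_div_mod)
  also have "\<dots> = (\<Sum>K\<in>S. \<Sum>c<q\<^sup>2. of_bool (I \<noteq> K \<and> C_rel (label I K) \<alpha> i' c)
          * of_bool (J \<noteq> K \<and> C_rel (label J K) \<alpha> j' c))"
    by (rule sum.mono_neutral_right) (auto simp: S_def)
  also have "\<dots> = (\<Sum>K\<in>S. w K)"
  proof (rule sum.cong)
    fix K assume K: "K \<in> S"
    then have "label I K \<in> index_symbols" "label J K \<in> index_symbols"
      using IJ label_in by (auto simp: S_def)
    from C_rel_row_product[OF this, of \<alpha> i' j'] K
    show "(\<Sum>c<q\<^sup>2. of_bool (I \<noteq> K \<and> C_rel (label I K) \<alpha> i' c)
          * of_bool (J \<noteq> K \<and> C_rel (label J K) \<alpha> j' c)) = w K"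
      by (auto simp: S_def w_def)
  qed simp
  also have "\<dots> = real (2 * q\<^sup>2) * of_bool (i = j) + real (2 * q) + real q * of_bool (T_rel i j)"
  proof (cases "I = J")
    case True
    \<comment> \<open>Grouping by label: each symbol labels exactly two \<open>K\<close>, one on
      either side of \<open>I\<close>, so the sum over \<open>S\<close> is twice a sum over symbols,
      to which \<open>sum_C_rel\<close> applies.\<close>
    have "(\<Sum>K\<in>S. w K) = (\<Sum>a\<in>index_symbols. \<Sum>K\<in>{K \<in> S. label I K = a}. w K)"
      using IJ True label_in by (intro sum.group[symmetric]) (auto simp: S_def finite_index_symbols)
    also have "\<dots> = (\<Sum>a\<in>index_symbols. 2 * (real q * of_bool (C_rel a 0 i' j')))"
    proof (rule sum.cong)
      fix a :: "'f symbol" assume a: "a \<in> index_symbols"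
      have "{K \<in> S. label I K = a} = {K. K < M \<and> cdist M I K = \<phi> a}"
      proof -
        have "K \<in> S \<and> label I K = a \<longleftrightarrow> K < M \<and> cdist M I K = \<phi> a" for K
          using True \<phi>_bounds[OF a] label_eq_iff[OF IJ(1), of K a] a cdist_eq_0_iff[OF IJ(1) IJ(1)]
          by (cases "K = I") (auto simp: S_def)
        then show ?thesis by blast
      qed
      then have "card {K \<in> S. label I K = a} = 2"
        using card_cdist_eq[OF IJ(1), of "\<phi> a"] \<phi>_bounds[OF a] by simp
      moreover have "(\<Sum>K\<in>{K \<in> S. label I K = a}. w K)
          = (\<Sum>K\<in>{K \<in> S. label I K = a}. real q * of_bool (C_rel a 0 i' j'))"
        using True by (intro sum.cong) (auto simp: w_def)
      ultimately show "(\<Sum>K\<in>{K \<in> S. label I K = a}. w K) = 2 * (real q * of_bool (C_rel a 0 i' j'))"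
        by simp
    qed simp
    also have "\<dots> = 2 * real q * (\<Sum>a\<in>index_symbols. of_bool (C_rel a 0 i' j'))"
      by (simp add: sum_distrib_left mult.assoc)
    also have "\<dots> = 2 * real q * (real q * of_bool (i' = j') + 1)"
      by (simp only: sum_C_rel[OF ij'])
    also have "i' = j' \<longleftrightarrow> i = j"
      using True unfolding I_def J_def i'_def j'_def by (metis div_mult_mod_eq)
    finally show ?thesis
      using True unfolding T_rel_def I_def[symmetric] J_def[symmetric]
      by (simp add: power2_eq_square algebra_simps)
  next
    case False
    let ?K = "cmid M I J"
    have K: "?K < M" using IJ by (intro cmid_less) auto
    have "?K \<noteq> I" "?K \<noteq> J"
      using cdist_eq_iff_cmid[OF IJ _ False K] cdist_eq_0_iff[OF IJ(1) K] cdist_eq_0_iff[OF IJ(2) K] False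
      by auto
    then have KS: "?K \<in> S" using K by (simp add: S_def)
    have lab: "label I L = label J L \<longleftrightarrow> L = ?K" if "L \<in> S" for L
      using that label_eq_label_iff[OF IJ _ False, of L] by (auto simp: S_def)
    have fin: "finite S" by (simp add: S_def)
    \<comment> \<open>Of these \<open>2 * q + 1\<close> indices the midpoint gives the
      \<open>T_rel\<close> term, and each of the other \<open>2 * q\<close> contributes 1.\<close>
    have "card S = 2 * q + 1" using IJ False by (simp add: S_def card_Diff_subset)
    moreover have "(\<Sum>K\<in>S - {?K}. w K) = (\<Sum>K\<in>S - {?K}. 1)"
      using lab by (intro sum.cong) (auto simp: w_def)
    ultimately have "(\<Sum>K\<in>S - {?K}. w K) = 2 * q"
      using KS fin by simp
    moreover have "(\<Sum>K\<in>S. w K) = w ?K + (\<Sum>K\<in>S - {?K}. w K)"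
      by (rule sum.remove[OF fin KS])
    moreover have "w ?K = real q * of_bool (T_rel i j)"
      using lab[OF KS] False
      by (simp add: w_def T_rel_def I_def[symmetric] J_def[symmetric] i'_def[symmetric] j'_def[symmetric])
    moreover have "i \<noteq> j" using False by (auto simp: I_def J_def)
    ultimately show ?thesis by simp
  qed
  finally show ?thesis .
qed

lemma T_rel_diag: "\<not> T_rel i i"
  by (simp add: T_rel_def)

lemma N_rel_irrefl: "\<not> N_rel \<alpha> i i"
  by (simp add: N_rel_def)

text \<open>The case \<open>i = j\<close> is included because it yields the out-degrees.\<close>

lemma card_common_out:
  assumes "i < M * q\<^sup>2" "j < M * q\<^sup>2"
  shows "card {k. k < M * q\<^sup>2 \<and> N_rel \<alpha> i k \<and> N_rel \<alpha> j k}
    = (if i = j then 2 * q\<^sup>2 + 2 * q else if T_rel i j then 3 * q else 2 * q)"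
proof -
  have "real (card {k. k < M * q\<^sup>2 \<and> N_rel \<alpha> i k \<and> N_rel \<alpha> j k})
      = (\<Sum>k<M * q\<^sup>2. of_bool (N_rel \<alpha> i k \<and> N_rel \<alpha> j k))"
    by (simp add: sum_of_bool_eq Int_def conj_assoc)
  also have "\<dots> = (\<Sum>k<M * q\<^sup>2. of_bool (N_rel \<alpha> i k) * of_bool (N_rel \<alpha> j k))"
    by (simp only: of_bool_conj)
  also have "\<dots> = real (if i = j then 2 * q\<^sup>2 + 2 * q else if T_rel i j then 3 * q else 2 * q)"
    unfolding N_rel_row_product[OF assms] using T_rel_diag by auto
  finally show ?thesis by (simp only: of_nat_eq_iff)
qed

lemma card_common_in:
  assumes "i < M * q\<^sup>2" "j < M * q\<^sup>2"
  shows "card {k. k < M * q\<^sup>2 \<and> N_rel \<alpha> k i \<and> N_rel \<alpha> k j}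
    = (if i = j then 2 * q\<^sup>2 + 2 * q else if T_rel i j then 3 * q else 2 * q)"
proof -
  have "{k. k < M * q\<^sup>2 \<and> N_rel \<alpha> k i \<and> N_rel \<alpha> k j}
      = {k. k < M * q\<^sup>2 \<and> N_rel (- \<alpha>) i k \<and> N_rel (- \<alpha>) j k}"
    using assms N_rel_swap by blast
  then show ?thesis using card_common_out[OF assms] by simp
qed

lemma N_mat_gram:
  "N_mat p m crd e s \<alpha> * transpose_mat (N_mat p m crd e s \<alpha>) =
     real (2 * q\<^sup>2) \<cdot>\<^sub>m 1\<^sub>m (M * q\<^sup>2) + real (2 * q) \<cdot>\<^sub>m all_ones (M * q\<^sup>2)
     + real q \<cdot>\<^sub>m mat_sum (M * q\<^sup>2)
         (\<lambda>a. kron (mat_powi (shift_mat M) (2 * int (\<phi> a)) + mat_powi (shift_mat M) (- 2 * int (\<phi> a)))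
                   (C_mat p m crd e a 0)) index_symbols"
  (is "?N * _ = ?A + ?B + real q \<cdot>\<^sub>m ?T")
proof (rule eq_matI)
  have N: "?N \<in> carrier_mat (M * q\<^sup>2) (M * q\<^sup>2)" by (rule N_mat_carrier)
  have dims: "dim_row (mat_sum k f S) = k" "dim_col (mat_sum k f S) = k"
    for k f and S :: "'f symbol set"
    by (simp_all add: mat_sum_def)
  show "dim_row (?N * transpose_mat ?N) = dim_row (?A + ?B + real q \<cdot>\<^sub>m ?T)"
    "dim_col (?N * transpose_mat ?N) = dim_col (?A + ?B + real q \<cdot>\<^sub>m ?T)"
    using N by (simp_all add: dims)
  fix i j assume "i < dim_row (?A + ?B + real q \<cdot>\<^sub>m ?T)" "j < dim_col (?A + ?B + real q \<cdot>\<^sub>m ?T)"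
  then have ij: "i < M * q\<^sup>2" "j < M * q\<^sup>2" by (simp_all add: dims)
  have "(?N * transpose_mat ?N) $$ (i, j) = (\<Sum>k<M * q\<^sup>2. ?N $$ (i, k) * ?N $$ (j, k))"
    using N ij by (auto simp: scalar_prod_def atLeast0LessThan)
  also have "\<dots> = (\<Sum>k<M * q\<^sup>2. of_bool (N_rel \<alpha> i k) * of_bool (N_rel \<alpha> j k))"
    using ij by (intro sum.cong) (auto simp: N_mat_index)
  also have "\<dots> = real (2 * q\<^sup>2) * of_bool (i = j) + real (2 * q) + real q * ?T $$ (i, j)"
    by (simp only: N_rel_row_product[OF ij] T_mat_index[OF ij])
  also have "\<dots> = (?A + ?B + real q \<cdot>\<^sub>m ?T) $$ (i, j)"
    using ij by (simp add: dims all_ones_def)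
  finally show "(?N * transpose_mat ?N) $$ (i, j) = (?A + ?B + real q \<cdot>\<^sub>m ?T) $$ (i, j)" .
qed

section \<open>Degrees and common neighbours in the graphs\<close>

definition N_graph :: "'f \<Rightarrow> nat pair_pre_digraph" where
  "N_graph \<alpha> = \<lparr>pverts = {..<M * q\<^sup>2}, parcs = {(i, j). i < M * q\<^sup>2 \<and> j < M * q\<^sup>2 \<and> N_rel \<alpha> i j}\<rparr>"

lemma is_adjacency_mat_N_graph: "is_adjacency_mat (N_mat p m crd e s \<alpha>) (N_graph \<alpha>)"
  using N_mat_carrier[of \<alpha>] N_mat_index[of _ _ \<alpha>]
  by (auto simp: is_adjacency_mat_def N_graph_def)

lemma pair_digraph_N_graph: "pair_digraph (N_graph \<alpha>)"
proof
  show "finite (parcs (N_graph \<alpha>))"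
    by (rule finite_subset[of _ "{..<M * q\<^sup>2} \<times> {..<M * q\<^sup>2}"]) (auto simp: N_graph_def)
qed (auto simp: N_graph_def N_rel_irrefl)

lemma out_degree_N_graph:
  assumes "i < M * q\<^sup>2"
  shows "out_degree (with_proj (N_graph \<alpha>)) i = 2 * q\<^sup>2 + 2 * q"
proof -
  have "out_arcs (with_proj (N_graph \<alpha>)) i = Pair i ` {k. k < M * q\<^sup>2 \<and> N_rel \<alpha> i k}"
    using assms by (auto simp: out_arcs_def N_graph_def)
  then show ?thesis
    using card_common_out[OF assms assms, of \<alpha>] by (simp add: out_degree_def card_image inj_on_def)
qed

lemma in_degree_N_graph:
  assumes "i < M * q\<^sup>2"
  shows "in_degree (with_proj (N_graph \<alpha>)) i = 2 * q\<^sup>2 + 2 * q"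
proof -
  have "in_arcs (with_proj (N_graph \<alpha>)) i = (\<lambda>k. (k, i)) ` {k. k < M * q\<^sup>2 \<and> N_rel \<alpha> k i}"
    using assms by (auto simp: in_arcs_def N_graph_def)
  then show ?thesis
    using card_common_in[OF assms assms, of \<alpha>] by (simp add: in_degree_def card_image inj_on_def)
qed

lemma common_out_N_graph:
  assumes "i < M * q\<^sup>2" "j < M * q\<^sup>2"
  shows "{k. (i, k) \<in> parcs (N_graph \<alpha>) \<and> (j, k) \<in> parcs (N_graph \<alpha>)}
    = {k. k < M * q\<^sup>2 \<and> N_rel \<alpha> i k \<and> N_rel \<alpha> j k}"
  using assms by (auto simp: N_graph_def)

lemma common_in_N_graph:
  assumes "i < M * q\<^sup>2" "j < M * q\<^sup>2"
  shows "{k. (k, i) \<in> parcs (N_graph \<alpha>) \<and> (k, j) \<in> parcs (N_graph \<alpha>)}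
    = {k. k < M * q\<^sup>2 \<and> N_rel \<alpha> k i \<and> N_rel \<alpha> k j}"
  using assms by (auto simp: N_graph_def)

lemma pverts_N_graph: "pverts (N_graph \<alpha>) = {..<M * q\<^sup>2}"
  by (simp add: N_graph_def)

lemma deza_graph_N_graph_0: "deza_graph (N_graph 0) (M * q\<^sup>2) (2 * q\<^sup>2 + 2 * q) (3 * q) (2 * q)"
proof -
  interpret G: pair_digraph "N_graph 0" by (rule pair_digraph_N_graph)
  \<comment> \<open>Reversing arcs replaces \<alpha> by its negative, and 0 is its own
    negative.\<close>
  have "symmetric (with_proj (N_graph 0))"
    using N_rel_swap[of _ _ 0] by (auto simp: symmetric_def sym_def N_graph_def with_proj_def arcs_ends_conv)
  then have "pair_graph (N_graph 0)" by unfold_locales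
  then show ?thesis
    unfolding deza_graph_def pverts_N_graph
    by (auto simp: out_degree_N_graph common_out_N_graph card_common_out)
qed

lemma directed_deza_graph_II_N_graph:
  "directed_deza_graph_II (N_graph \<alpha>) (M * q\<^sup>2) (2 * q\<^sup>2 + 2 * q) (3 * q) (2 * q)"
proof -
  \<comment> \<open>With \<open>q * q\<^sup>2\<close> treated as an atom, the inequalities between
    the parameters become linear.\<close>
  have "q \<le> q\<^sup>2" "q \<le> q * q\<^sup>2" using q(2) by (auto simp: power2_eq_square)
  moreover have "M * q\<^sup>2 = 2 * (q * q\<^sup>2) + 3 * q\<^sup>2" by (simp add: algebra_simps)
  ultimately have "3 * q \<le> 2 * q\<^sup>2 + 2 * q" "2 * q\<^sup>2 + 2 * q \<le> M * q\<^sup>2"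
    by linarith+
  then show ?thesis
    using pair_digraph_N_graph
    unfolding directed_deza_graph_II_def pverts_N_graph
    by (auto simp: out_degree_N_graph in_degree_N_graph common_out_N_graph common_in_N_graph
        card_common_out card_common_in)
qed

end

theorem corollary5p8:
  fixes p m q n :: nat
    and crd :: "'f::{finite,field} \<Rightarrow> nat \<Rightarrow> nat"
    and e :: "nat \<Rightarrow> 'f"
    and s :: "nat \<Rightarrow> 'f symbol"
    and \<phi> :: "'f symbol \<Rightarrow> nat"
    and V :: "real mat"
  assumes "prime p" and "odd p" and "q = p ^ m" and "card (UNIV :: 'f set) = q"
    and n: "n = q ^ 2 * (2 * q + 3)"
    and V: "V = shift_mat (2 * q + 3)"
    and crd: "coordinatization p m crd"
    and e: "bij_betw e {..<q} UNIV"
    and s: "s 1 = SymX" "s 2 = SymY" "s ` {3..q + 2} = range Fld"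
      "\<forall>i\<in>{1..2 * q + 2}. s (2 * q + 4 - i) = s (i + 1)"
    and \<phi>: "bij_betw \<phi> index_symbols {1..q + 1}"
      "\<forall>a\<in>index_symbols. P_mat q s a = mat_powi V (int (\<phi> a)) + mat_powi V (- int (\<phi> a))"
  shows "(\<forall>\<alpha>. N_mat p m crd e s \<alpha> * transpose_mat (N_mat p m crd e s \<alpha>) =
            real (2 * q ^ 2) \<cdot>\<^sub>m 1\<^sub>m n + real (2 * q) \<cdot>\<^sub>m all_ones n
            + real q \<cdot>\<^sub>m mat_sum n
                (\<lambda>a. kron (mat_powi V (2 * int (\<phi> a)) + mat_powi V (- 2 * int (\<phi> a)))
                          (C_mat p m crd e a 0)) index_symbols)
    \<and> (\<exists>G. is_adjacency_mat (N_mat p m crd e s 0) G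
          \<and> deza_graph G n (2 * q ^ 2 + 2 * q) (3 * q) (2 * q))
    \<and> (\<forall>\<alpha>. \<alpha> \<noteq> 0 \<longrightarrow> (\<exists>G. is_adjacency_mat (N_mat p m crd e s \<alpha>) G
          \<and> directed_deza_graph_II G n (2 * q ^ 2 + 2 * q) (3 * q) (2 * q)))"
proof -
  have q: "q > 0" using \<open>prime p\<close> \<open>q = p ^ m\<close> by (simp add: prime_gt_0_nat)
  \<comment> \<open>Any labelling \<open>g\<close> that turns every \<open>phi_mat\<close> into a
    translation will do; the claim does not mention it.\<close>
  obtain g where g: "bij_betw g {..<q} UNIV"
    "\<And>x. phi_mat p m crd x \<in> carrier_mat q q"
    "\<And>x i j. i < q \<Longrightarrow> j < q \<Longrightarrow> phi_mat p m crd x $$ (i, j) = of_bool (g j = g i + x)"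
    using phi_mat_translation[OF prime_ge_2_nat[OF \<open>prime p\<close>] _ crd] assms(3,4) by metis
  interpret deza_construction p m q crd e g s \<phi>
    using q g assms(3) e \<phi> V by unfold_locales auto
  have "n = M * q\<^sup>2" by (simp add: n)
  then show ?thesis
    using N_mat_gram is_adjacency_mat_N_graph deza_graph_N_graph_0 directed_deza_graph_II_N_graph
    unfolding V by blast
qed

end
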